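(* A discrete combinatory object is isomorphic (in the category $\mathbf{DCO}$) to the DCO $(\mathcal{A},\mathcal{F}_{\mathcal{A}})$ induced by some partial combinatory algebra $(\mathcal{A},\cdot)$ if and only if it is cartesian, shallow, and functionally complete.
   Context: **Partial functions.** Partial functions are identified with their graphs, compared by inclusion $\subseteq$ and composed as relations. For partially defined terms, $t\downarrow$ means $t$ is defined, and $s\preceq t$ means: if $s$ is defined then $t$ is defined and $s=t$. **DCOs.** A discrete combinatory object (DCO) is a pair $(A,\mathcal{F}_A)$ with $A$ a set and $\mathcal{F}_A$ a set of partial endofunctions on $A$ containing $\mathrm{id}_A$ and such that for all $\alpha,\beta\in\mathcal{F}_A$ there is $\gamma\in\mathcal{F}_A$ with $\beta\circ\alpha\subseteq\gamma$. A DCO morphism $(A,\mathcal{F}_A)\to(B,\mathcal{F}_B)$ is a function $f:A\to B$ such that for all $\alpha\in\mathcal{F}_A$ there is $\beta\in\mathcal{F}_B$ with $f\circ\alpha\subseteq\beta\circ f$. Morphisms are preordered by $f\leq g$ iff there is $\beta\in\mathcal{F}_B$ with $\beta\circ f=g$. This gives a locally (pre)ordered category $\mathbf{DCO}$, with terminal object $(1,\{\mathrm{id}\})$ and binary products $(A\times B,\{\alpha\times\beta\mid\alpha\in\mathcal{F}_A,\beta\in\mathcal{F}_B\})$, where $\alpha\times\beta$ is the componentwise partial function. **Shallow.** $(A,\mathcal{F}_A)$ is shallow if the set $A$, preordered by $a\leq b$ iff $\alpha(a)=b$ for some $\alpha\in\mathcal{F}_A$, is equivalent to the terminal preorder (i.e.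 $A$ is inhabited and $a\leq b$ for all $a,b\in A$). **Cartesian.** $(A,\mathcal{F}_A)$ is cartesian if the DCO morphisms $!_A:A\to1$ and $\delta_A:A\to A\times A$ (diagonal) have right adjoints $\top:1\to A$ and $\wedge:A\times A\to A$ in $\mathbf{DCO}$. **Functionally complete.** A cartesian DCO is functionally complete if there is $@\in\mathcal{F}_A$ such that for every $\alpha\in\mathcal{F}_A$ there is a total $\widetilde\alpha\in\mathcal{F}_A$ with $\alpha(a\wedge b)\preceq @(\widetilde\alpha(a)\wedge b)$ for all $a,b\in A$. **PCAs.** A partial applicative structure is a set $\mathcal{A}$ with a partial binary operation $(-\cdot-):\mathcal{A}\times\mathcal{A}\rightharpoonup\mathcal{A}$ (application, associating to the left). A polynomial over $\mathcal{A}$ is a term $t[x_1,\dots,x_n]$ built from variables, constants in $\mathcal{A}$, and application. A partial combinatory algebra (PCA) is a partial applicative structure such that for every polynomial $t[x_1,\dots,x_{n+1}]$ there is $e\in\mathcal{A}$ with $e\cdot a_1\cdot\ldots\cdot a_n\downarrow$ and $t[a_1,\dots,a_{n+1}]\preceq e\cdot a_1\cdot\ldots\cdot a_{n+1}$ for all $a_1,\dots,a_{n+1}\in\mathcal{A}$. The DCO induced by $(\mathcal{A},\cdot)$ is $(\mathcal{A},\mathcal{F}_{\mathcal{A}})$ with $\mathcal{F}_{\mathcal{A}}=\{\phi_a\mid a\in\mathcal{A}\}$, where $\phi_a:\mathcal{A}\rightharpoonup\mathcal{A}$ is the partial function $b\mapsto a\cdot b$. *)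

theory Defs
  imports Main
begin

section \<open>Discrete combinatory objects\<close>

text \<open>
  Partial functions are maps \<^typ>\<open>'a \<rightharpoonup> 'a\<close>, with graph inclusion \<open>\<subseteq>\<^sub>m\<close> and relational composition
  \<open>\<circ>\<^sub>m\<close>. The underlying set is an explicit carrier, since it may be empty; the partial functions of
  a DCO are undefined outside the carrier, so that equal graphs are equal maps.
\<close>

record 'a dco =
  carrier :: "'a set"
  pfuns :: "('a \<rightharpoonup> 'a) set"

definition is_dco :: "'a dco \<Rightarrow> bool" where
  "is_dco D \<longleftrightarrow>
     (\<forall>\<alpha>\<in>pfuns D. dom \<alpha> \<subseteq> carrier D \<and> ran \<alpha> \<subseteq> carrier D) \<and>
     Some |` carrier D \<in> pfuns D \<and>
     (\<forall>\<alpha>\<in>pfuns D. \<forall>\<beta>\<in>pfuns D. \<exists>\<gamma>\<in>pfuns D. \<beta> \<circ>\<^sub>m \<alpha> \<subseteq>\<^sub>m \<gamma>)"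

text \<open>
  A function between carriers is a HOL function of which only the values on the carrier matter.
  In \<open>dco_mor\<close> the left-hand side of the inclusion is defined on a subset of the carrier only, so
  the values of \<open>f\<close> elsewhere are irrelevant there too.
\<close>

definition dco_mor :: "'a dco \<Rightarrow> 'b dco \<Rightarrow> ('a \<Rightarrow> 'b) \<Rightarrow> bool" where
  "dco_mor D E f \<longleftrightarrow>
     f ` carrier D \<subseteq> carrier E \<and>
     (\<forall>\<alpha>\<in>pfuns D. \<exists>\<beta>\<in>pfuns E. (map_option f \<circ> \<alpha>) \<subseteq>\<^sub>m (\<beta> \<circ> f))"

definition dco_le :: "'a dco \<Rightarrow> 'b dco \<Rightarrow> ('a \<Rightarrow> 'b) \<Rightarrow> ('a \<Rightarrow> 'b) \<Rightarrow> bool" where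
  "dco_le D E f g \<longleftrightarrow> (\<exists>\<beta>\<in>pfuns E. \<forall>a\<in>carrier D. \<beta> (f a) = Some (g a))"

definition dco_isomorphic :: "'a dco \<Rightarrow> 'b dco \<Rightarrow> bool" where
  "dco_isomorphic D E \<longleftrightarrow>
     (\<exists>f g. dco_mor D E f \<and> dco_mor E D g \<and>
        (\<forall>a\<in>carrier D. g (f a) = a) \<and> (\<forall>b\<in>carrier E. f (g b) = b))"

text \<open>Adjunctions \<open>f \<stileturn> g\<close> in a locally preordered category, by unit and counit.\<close>

definition dco_adjoint :: "'a dco \<Rightarrow> 'b dco \<Rightarrow> ('a \<Rightarrow> 'b) \<Rightarrow> ('b \<Rightarrow> 'a) \<Rightarrow> bool" where
  "dco_adjoint D E f g \<longleftrightarrow>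
     dco_mor D E f \<and> dco_mor E D g \<and> dco_le D D id (g \<circ> f) \<and> dco_le E E (f \<circ> g) id"

definition dco_one :: "unit dco" where
  "dco_one = \<lparr>carrier = UNIV, pfuns = {Some}\<rparr>"

definition pfun_prod :: "('a \<rightharpoonup> 'a) \<Rightarrow> ('b \<rightharpoonup> 'b) \<Rightarrow> ('a \<times> 'b \<rightharpoonup> 'a \<times> 'b)" where
  "pfun_prod \<alpha> \<beta> = (\<lambda>(a, b). Option.bind (\<alpha> a) (\<lambda>a'. Option.bind (\<beta> b) (\<lambda>b'. Some (a', b'))))"

definition dco_prod :: "'a dco \<Rightarrow> 'b dco \<Rightarrow> ('a \<times> 'b) dco" where
  "dco_prod D E =
     \<lparr>carrier = carrier D \<times> carrier E,
      pfuns = {pfun_prod \<alpha> \<beta> | \<alpha> \<beta>. \<alpha> \<in> pfuns D \<and> \<beta> \<in> pfuns E}\<rparr>"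

definition shallow :: "'a dco \<Rightarrow> bool" where
  "shallow D \<longleftrightarrow>
     carrier D \<noteq> {} \<and> (\<forall>a\<in>carrier D. \<forall>b\<in>carrier D. \<exists>\<alpha>\<in>pfuns D. \<alpha> a = Some b)"

definition is_top :: "'a dco \<Rightarrow> (unit \<Rightarrow> 'a) \<Rightarrow> bool" where
  "is_top D t \<longleftrightarrow> dco_adjoint D dco_one (\<lambda>_. ()) t"

definition is_meet :: "'a dco \<Rightarrow> ('a \<times> 'a \<Rightarrow> 'a) \<Rightarrow> bool" where
  "is_meet D m \<longleftrightarrow> dco_adjoint D (dco_prod D D) (\<lambda>a. (a, a)) m"

definition cartesian :: "'a dco \<Rightarrow> bool" where
  "cartesian D \<longleftrightarrow> (\<exists>t. is_top D t) \<and> (\<exists>m. is_meet D m)"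

text \<open>The relation \<open>s \<preceq> t\<close> between partially defined terms.\<close>

definition def_le :: "'a option \<Rightarrow> 'a option \<Rightarrow> bool" (infix \<open>\<preceq>\<close> 50) where
  "s \<preceq> t \<longleftrightarrow> (s \<noteq> None \<longrightarrow> t \<noteq> None \<and> s = t)"

definition functionally_complete_wrt :: "'a dco \<Rightarrow> ('a \<times> 'a \<Rightarrow> 'a) \<Rightarrow> bool" where
  "functionally_complete_wrt D m \<longleftrightarrow>
     (\<exists>ap\<in>pfuns D. \<forall>\<alpha>\<in>pfuns D. \<exists>\<alpha>'\<in>pfuns D. dom \<alpha>' = carrier D \<and>
        (\<forall>a\<in>carrier D. \<forall>b\<in>carrier D.
           \<alpha> (m (a, b)) \<preceq> Option.bind (\<alpha>' a) (\<lambda>c. ap (m (c, b)))))"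

text \<open>
  The right adjoint \<open>m\<close> of the diagonal is unique only up to isomorphism; the choice does not
  matter, see \<open>functionally_complete_wrt_any_meet\<close> below.
\<close>

definition functionally_complete :: "'a dco \<Rightarrow> bool" where
  "functionally_complete D \<longleftrightarrow>
     cartesian D \<and> (\<exists>m. is_meet D m \<and> functionally_complete_wrt D m)"

lemma map_le_Some: "\<alpha> \<subseteq>\<^sub>m \<beta> \<Longrightarrow> \<alpha> x = Some y \<Longrightarrow> \<beta> x = Some y"
  by (metis domI map_le_def)

lemma meet_le_meet:
  assumes D: "is_dco D" and m: "is_meet D m" and m': "is_meet D m'"
  shows "\<exists>\<beta>\<in>pfuns D. \<forall>a\<in>carrier D. \<forall>b\<in>carrier D. \<beta> (m (a, b)) = Some (m' (a, b))"
proof -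
  have mc: "m (a, b) \<in> carrier D" if "a \<in> carrier D" "b \<in> carrier D" for a b
    using m that unfolding is_meet_def dco_adjoint_def dco_mor_def dco_prod_def by auto
  from m' obtain \<eta> where \<eta>: "\<eta> \<in> pfuns D" "\<And>a. a \<in> carrier D \<Longrightarrow> \<eta> a = Some (m' (a, a))"
    unfolding is_meet_def dco_adjoint_def dco_le_def by auto
  from m obtain p where p: "p \<in> pfuns (dco_prod D D)"
      "\<And>a b. a \<in> carrier D \<Longrightarrow> b \<in> carrier D \<Longrightarrow> p (m (a, b), m (a, b)) = Some (a, b)"
    unfolding is_meet_def dco_adjoint_def dco_le_def by (auto simp: dco_prod_def)
  from m' p(1) obtain \<gamma> where \<gamma>: "\<gamma> \<in> pfuns D" "(map_option m' \<circ> p) \<subseteq>\<^sub>m (\<gamma> \<circ> m')"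
    unfolding is_meet_def dco_adjoint_def dco_mor_def by blast
  from D \<eta>(1) \<gamma>(1) obtain \<beta> where \<beta>: "\<beta> \<in> pfuns D" "\<gamma> \<circ>\<^sub>m \<eta> \<subseteq>\<^sub>m \<beta>"
    unfolding is_dco_def by blast
  have "\<beta> (m (a, b)) = Some (m' (a, b))" if ab: "a \<in> carrier D" "b \<in> carrier D" for a b
  proof -
    have "\<gamma> (m' (m (a, b), m (a, b))) = Some (m' (a, b))"
      using map_le_Some[OF \<gamma>(2), of "(m (a, b), m (a, b))" "m' (a, b)"] p(2)[OF ab] by simp
    then have "(\<gamma> \<circ>\<^sub>m \<eta>) (m (a, b)) = Some (m' (a, b))"
      using \<eta>(2) mc[OF ab] by (simp add: map_comp_def)
    then show ?thesis by (rule map_le_Some[OF \<beta>(2)])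
  qed
  with \<beta>(1) show ?thesis by blast
qed

lemma functionally_complete_wrt_any_meet:
  assumes D: "is_dco D" and m: "is_meet D m" and m': "is_meet D m'"
    and fc: "functionally_complete_wrt D m"
  shows "functionally_complete_wrt D m'"
proof -
  obtain \<beta> where \<beta>: "\<beta> \<in> pfuns D"
      "\<And>a b. a \<in> carrier D \<Longrightarrow> b \<in> carrier D \<Longrightarrow> \<beta> (m (a, b)) = Some (m' (a, b))"
    using meet_le_meet[OF D m m'] by blast
  obtain \<beta>' where \<beta>': "\<beta>' \<in> pfuns D"
      "\<And>a b. a \<in> carrier D \<Longrightarrow> b \<in> carrier D \<Longrightarrow> \<beta>' (m' (a, b)) = Some (m (a, b))"
    using meet_le_meet[OF D m' m] by blast
  from fc obtain ap where ap: "ap \<in> pfuns D"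
      "\<And>\<alpha>. \<alpha> \<in> pfuns D \<Longrightarrow> \<exists>\<alpha>'\<in>pfuns D. dom \<alpha>' = carrier D \<and>
         (\<forall>a\<in>carrier D. \<forall>b\<in>carrier D.
            \<alpha> (m (a, b)) \<preceq> Option.bind (\<alpha>' a) (\<lambda>c. ap (m (c, b))))"
    unfolding functionally_complete_wrt_def by blast
  from D ap(1) \<beta>'(1) obtain ap' where ap': "ap' \<in> pfuns D" "ap \<circ>\<^sub>m \<beta>' \<subseteq>\<^sub>m ap'"
    unfolding is_dco_def by blast
  have "\<exists>\<alpha>'\<in>pfuns D. dom \<alpha>' = carrier D \<and>
         (\<forall>a\<in>carrier D. \<forall>b\<in>carrier D.
            \<alpha> (m' (a, b)) \<preceq> Option.bind (\<alpha>' a) (\<lambda>c. ap' (m' (c, b))))"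
    if \<alpha>: "\<alpha> \<in> pfuns D" for \<alpha>
  proof -
    from D \<alpha> \<beta>(1) obtain \<delta> where \<delta>: "\<delta> \<in> pfuns D" "\<alpha> \<circ>\<^sub>m \<beta> \<subseteq>\<^sub>m \<delta>"
      unfolding is_dco_def by blast
    from ap(2)[OF \<delta>(1)] obtain \<alpha>' where \<alpha>': "\<alpha>' \<in> pfuns D" "dom \<alpha>' = carrier D"
        "\<And>a b. a \<in> carrier D \<Longrightarrow> b \<in> carrier D \<Longrightarrow>
            \<delta> (m (a, b)) \<preceq> Option.bind (\<alpha>' a) (\<lambda>c. ap (m (c, b)))"
      by blast
    have "\<alpha> (m' (a, b)) \<preceq> Option.bind (\<alpha>' a) (\<lambda>c. ap' (m' (c, b)))"
      if ab: "a \<in> carrier D" "b \<in> carrier D" for a b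
    proof (cases "\<alpha> (m' (a, b))")
      case None
      then show ?thesis by (simp add: def_le_def)
    next
      case (Some x)
      then have "(\<alpha> \<circ>\<^sub>m \<beta>) (m (a, b)) = Some x"
        using \<beta>(2)[OF ab] by (simp add: map_comp_def)
      then have "\<delta> (m (a, b)) = Some x" by (rule map_le_Some[OF \<delta>(2)])
      then have "Option.bind (\<alpha>' a) (\<lambda>c. ap (m (c, b))) = Some x"
        using \<alpha>'(3)[OF ab] by (simp add: def_le_def)
      then obtain c where c: "\<alpha>' a = Some c" "ap (m (c, b)) = Some x"
        by (auto simp: bind_eq_Some_conv)
      have "c \<in> carrier D"
        using D \<alpha>'(1) c(1) unfolding is_dco_def by (meson ranI subsetD)
      then have "(ap \<circ>\<^sub>m \<beta>') (m' (c, b)) = Some x"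
        using \<beta>'(2) ab(2) c(2) by (simp add: map_comp_def)
      then have "ap' (m' (c, b)) = Some x" by (rule map_le_Some[OF ap'(2)])
      then show ?thesis using c(1) Some by (simp add: def_le_def)
    qed
    with \<alpha>'(1,2) show ?thesis by blast
  qed
  with ap'(1) show ?thesis unfolding functionally_complete_wrt_def by blast
qed


section \<open>Partial combinatory algebras\<close>

record 'a pas =
  pcarrier :: "'a set"
  app :: "'a \<Rightarrow> 'a \<Rightarrow> 'a option"

text \<open>Only the application of elements of the carrier matters.\<close>

definition is_pas :: "'a pas \<Rightarrow> bool" where
  "is_pas P \<longleftrightarrow>
     (\<forall>a\<in>pcarrier P. \<forall>b\<in>pcarrier P. \<forall>c. app P a b = Some c \<longrightarrow> c \<in> pcarrier P)"

text \<open>Polynomials; \<open>Var i\<close> stands for the variable \<open>x\<^sub>i\<^sub>+\<^sub>1\<close>.\<close>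

datatype 'a pterm = Var nat | Const 'a | App "'a pterm" "'a pterm"

primrec term_vars :: "'a pterm \<Rightarrow> nat set" where
  "term_vars (Var i) = {i}"
| "term_vars (Const c) = {}"
| "term_vars (App s t) = term_vars s \<union> term_vars t"

primrec term_constants :: "'a pterm \<Rightarrow> 'a set" where
  "term_constants (Var i) = {}"
| "term_constants (Const c) = {c}"
| "term_constants (App s t) = term_constants s \<union> term_constants t"

definition is_polynomial :: "'a pas \<Rightarrow> nat \<Rightarrow> 'a pterm \<Rightarrow> bool" where
  "is_polynomial P k t \<longleftrightarrow> term_vars t \<subseteq> {..<k} \<and> term_constants t \<subseteq> pcarrier P"

primrec term_value :: "'a pas \<Rightarrow> 'a list \<Rightarrow> 'a pterm \<Rightarrow> 'a option" where
  "term_value P as (Var i) = Some (as ! i)"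
| "term_value P as (Const c) = Some c"
| "term_value P as (App s t) =
     Option.bind (term_value P as s) (\<lambda>u. Option.bind (term_value P as t) (\<lambda>v. app P u v))"

text \<open>The iterated application \<open>e \<cdot> a\<^sub>1 \<cdot> \<dots> \<cdot> a\<^sub>n\<close>, associated to the left.\<close>

definition app_list :: "'a pas \<Rightarrow> 'a \<Rightarrow> 'a list \<Rightarrow> 'a option" where
  "app_list P e as = foldl (\<lambda>r a. Option.bind r (\<lambda>u. app P u a)) (Some e) as"

definition is_pca :: "'a pas \<Rightarrow> bool" where
  "is_pca P \<longleftrightarrow> is_pas P \<and>
     (\<forall>n t. is_polynomial P (n + 1) t \<longrightarrow>
        (\<exists>e\<in>pcarrier P. \<forall>as. length as = n + 1 \<and> set as \<subseteq> pcarrier P \<longrightarrow>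
           app_list P e (take n as) \<noteq> None \<and> term_value P as t \<preceq> app_list P e as))"

definition induced_dco :: "'a pas \<Rightarrow> 'a dco" where
  "induced_dco P =
     \<lparr>carrier = pcarrier P, pfuns = {app P a |` pcarrier P | a. a \<in> pcarrier P}\<rparr>"

end

theory Submission
  imports Defs
begin

text \<open>
  In the converse direction application is \<open>a \<cdot> b = @(a \<and> b)\<close>. An argument list \<open>a\<^sub>1, \<dots>, a\<^sub>k\<close> is coded by
  the single element \<open>(\<dots>(\<top> \<and> a\<^sub>1) \<and> \<dots>) \<and> a\<^sub>k\<close>. Every polynomial is dominated by an element of \<open>\<F>\<close>
  acting on codes, because projections, constants (by shallowness), pairing and \<open>@\<close> are available, and
  iterated functional completeness curries this element into a representing element of the PCA.
\<close>

section \<open>Discrete combinatory objects\<close>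

text \<open>Composites of members of \<open>pfuns\<close> are only contained in members, never known
  to be members. Hence every construction is tracked by implications between defined values, and
  polynomials can only be compared through \<open>\<preceq>\<close>. This relation says nothing
  where a polynomial is undefined, so it cannot yield the clause that e a1 ... an is always defined;
  in the converse direction that clause comes from the totality of the transposes.

  The top element links functions and elements: it is the base point of all codes, and evaluating an
  iterated transpose there gives an element of the carrier. Shallowness provides the return passage,
  since the function represented by an element a pairs its argument with the constant a before
  applying \<open>ap\<close>.

  For the direction from PCAs, polynomials in at most three variables are enough: Church pairing is
  the meet, the polynomial (p x)(q x) is evaluation, and the clause that e a is defined for a
  two-variable polynomial makes the transposes total. The properties are then carried along the
  isomorphism.\<close>

lemma pfuns_closed:
  assumes "is_dco D" "\<alpha> \<in> pfuns D" "\<alpha> x = Some y"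
  shows "x \<in> carrier D" "y \<in> carrier D"
  using assms unfolding is_dco_def by (meson domI ranI subsetD)+

lemma pfuns_id:
  assumes "is_dco D"
  obtains \<iota> where "\<iota> \<in> pfuns D" "\<And>x. x \<in> carrier D \<Longrightarrow> \<iota> x = Some x"
  using assms unfolding is_dco_def by (metis restrict_in)

lemma pfuns_comp:
  assumes "is_dco D" "\<alpha> \<in> pfuns D" "\<beta> \<in> pfuns D"
  obtains \<gamma> where "\<gamma> \<in> pfuns D" "\<And>x y z. \<alpha> x = Some y \<Longrightarrow> \<beta> y = Some z \<Longrightarrow> \<gamma> x = Some z"
proof -
  obtain \<gamma> where \<gamma>: "\<gamma> \<in> pfuns D" "\<beta> \<circ>\<^sub>m \<alpha> \<subseteq>\<^sub>m \<gamma>"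
    using assms unfolding is_dco_def by blast
  have "\<gamma> x = Some z" if "\<alpha> x = Some y" "\<beta> y = Some z" for x y z
    by (rule map_le_Some[OF \<gamma>(2)]) (simp add: map_comp_def that)
  with \<gamma>(1) show ?thesis by (rule that)
qed

section \<open>Elementwise descriptions of morphisms, top and meet\<close>

lemma dco_mor_iff:
  "dco_mor D E f \<longleftrightarrow> (\<forall>a\<in>carrier D. f a \<in> carrier E) \<and>
     (\<forall>\<alpha>\<in>pfuns D. \<exists>\<beta>\<in>pfuns E. \<forall>x y. \<alpha> x = Some y \<longrightarrow> \<beta> (f x) = Some (f y))"
proof -
  have "(map_option f \<circ> \<alpha>) \<subseteq>\<^sub>m (\<beta> \<circ> f) \<longleftrightarrow> (\<forall>x y. \<alpha> x = Some y \<longrightarrow> \<beta> (f x) = Some (f y))"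
    for \<alpha> \<beta>
    unfolding map_le_def dom_def by force
  then show ?thesis unfolding dco_mor_def by auto
qed

text \<open>Most of the adjunction is automatic: the terminal DCO has one point and only the
  identity, and the identity of \<open>D\<close> shows that \<open>t\<close> is a morphism. The
  unit, which compares \<open>id\<close> with the constant map at \<open>t ()\<close>, is what
  carries information.\<close>

lemma is_top_iff:
  assumes D: "is_dco D"
  shows "is_top D t \<longleftrightarrow>
    t () \<in> carrier D \<and> (\<exists>\<tau>\<in>pfuns D. \<forall>a\<in>carrier D. \<tau> a = Some (t ()))"
proof -
  obtain \<iota> where \<iota>: "\<iota> \<in> pfuns D" "\<And>x. x \<in> carrier D \<Longrightarrow> \<iota> x = Some x"
    using pfuns_id[OF D] by blast
  then show ?thesis
    unfolding is_top_def dco_adjoint_def dco_mor_iff dco_le_def dco_one_def by auto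
qed

lemma pfun_prod_eq_Some_iff:
  "pfun_prod \<alpha> \<beta> (a, b) = Some (a', b') \<longleftrightarrow> \<alpha> a = Some a' \<and> \<beta> b = Some b'"
  by (auto simp: pfun_prod_def bind_eq_Some_conv)

lemma dco_prod_sel:
  "carrier (dco_prod D E) = carrier D \<times> carrier E"
  "\<pi> \<in> pfuns (dco_prod D E) \<longleftrightarrow> (\<exists>\<alpha>\<in>pfuns D. \<exists>\<beta>\<in>pfuns E. \<pi> = pfun_prod \<alpha> \<beta>)"
  by (auto simp: dco_prod_def)

text \<open>The four conjuncts come from the adjunction in the order: \<open>m\<close> maps into the
  carrier, unit, counit, \<open>m\<close> preserves partial functions. The counit is a single member
  of the product, hence of the form \<open>pfun_prod p q\<close>, and its two factors act as
  projections. The diagonal is always a morphism, because \<open>pfun_prod \<alpha> \<alpha>\<close>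
  tracks \<alpha>.\<close>

lemma is_meet_iff:
  "is_meet D m \<longleftrightarrow>
    (\<forall>a\<in>carrier D. \<forall>b\<in>carrier D. m (a, b) \<in> carrier D) \<and>
    (\<exists>\<delta>\<in>pfuns D. \<forall>a\<in>carrier D. \<delta> a = Some (m (a, a))) \<and>
    (\<exists>p\<in>pfuns D. \<exists>q\<in>pfuns D. \<forall>a\<in>carrier D. \<forall>b\<in>carrier D.
       p (m (a, b)) = Some a \<and> q (m (a, b)) = Some b) \<and>
    (\<forall>\<alpha>\<in>pfuns D. \<forall>\<beta>\<in>pfuns D. \<exists>\<gamma>\<in>pfuns D. \<forall>a b a' b'.
       \<alpha> a = Some a' \<longrightarrow> \<beta> b = Some b' \<longrightarrow> \<gamma> (m (a, b)) = Some (m (a', b')))"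
proof -
  have ex: "(\<exists>\<pi>\<in>pfuns (dco_prod D D). Q \<pi>) \<longleftrightarrow> (\<exists>\<alpha>\<in>pfuns D. \<exists>\<beta>\<in>pfuns D. Q (pfun_prod \<alpha> \<beta>))"
    for Q unfolding Bex_def dco_prod_sel by iprover
  have all: "(\<forall>\<pi>\<in>pfuns (dco_prod D D). Q \<pi>) \<longleftrightarrow> (\<forall>\<alpha>\<in>pfuns D. \<forall>\<beta>\<in>pfuns D. Q (pfun_prod \<alpha> \<beta>))"
    for Q unfolding Ball_def Bex_def dco_prod_sel by iprover
  have "dco_mor D (dco_prod D D) (\<lambda>a. (a, a))"
    unfolding dco_mor_iff ex by (auto simp: dco_prod_sel pfun_prod_eq_Some_iff)
  moreover have "dco_mor (dco_prod D D) D m \<longleftrightarrow>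
    (\<forall>a\<in>carrier D. \<forall>b\<in>carrier D. m (a, b) \<in> carrier D) \<and>
    (\<forall>\<alpha>\<in>pfuns D. \<forall>\<beta>\<in>pfuns D. \<exists>\<gamma>\<in>pfuns D. \<forall>a b a' b'.
       \<alpha> a = Some a' \<longrightarrow> \<beta> b = Some b' \<longrightarrow> \<gamma> (m (a, b)) = Some (m (a', b')))"
    unfolding dco_mor_iff all
    by (simp add: dco_prod_sel(1) pfun_prod_eq_Some_iff imp_conjL)
  moreover have "dco_le (dco_prod D D) (dco_prod D D) ((\<lambda>a. (a, a)) \<circ> m) id \<longleftrightarrow>
    (\<exists>p\<in>pfuns D. \<exists>q\<in>pfuns D. \<forall>a\<in>carrier D. \<forall>b\<in>carrier D.
       p (m (a, b)) = Some a \<and> q (m (a, b)) = Some b)"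
    unfolding dco_le_def ex by (simp add: dco_prod_sel(1) pfun_prod_eq_Some_iff)
  moreover have "dco_le D D id (m \<circ> (\<lambda>a. (a, a))) \<longleftrightarrow>
    (\<exists>\<delta>\<in>pfuns D. \<forall>a\<in>carrier D. \<delta> a = Some (m (a, a)))"
    unfolding dco_le_def by simp
  ultimately show ?thesis
    unfolding is_meet_def dco_adjoint_def by (simp only: conj_ac simp_thms)
qed

section \<open>Operations on partial functions supplied by meet, top and shallowness\<close>

lemma meet_closed:
  assumes "is_meet D m" "a \<in> carrier D" "b \<in> carrier D"
  shows "m (a, b) \<in> carrier D"
  using assms(2,3) assms(1)[unfolded is_meet_iff, THEN conjunct1] by blast

lemma meet_diag:
  assumes "is_meet D m"
  obtains \<delta> where "\<delta> \<in> pfuns D" "\<And>a. a \<in> carrier D \<Longrightarrow> \<delta> a = Some (m (a, a))"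
  using assms[unfolded is_meet_iff, THEN conjunct2, THEN conjunct1] by blast

lemma meet_proj:
  assumes "is_meet D m"
  obtains p q where "p \<in> pfuns D" "q \<in> pfuns D"
    "\<And>a b. a \<in> carrier D \<Longrightarrow> b \<in> carrier D \<Longrightarrow> p (m (a, b)) = Some a"
    "\<And>a b. a \<in> carrier D \<Longrightarrow> b \<in> carrier D \<Longrightarrow> q (m (a, b)) = Some b"
  using assms[unfolded is_meet_iff, THEN conjunct2, THEN conjunct2, THEN conjunct1] by blast

lemma meet_map:
  assumes "is_meet D m" "\<alpha> \<in> pfuns D" "\<beta> \<in> pfuns D"
  obtains \<gamma> where "\<gamma> \<in> pfuns D"
    "\<And>a b a' b'. \<alpha> a = Some a' \<Longrightarrow> \<beta> b = Some b' \<Longrightarrow> \<gamma> (m (a, b)) = Some (m (a', b'))"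
proof -
  note meet = assms(1)[unfolded is_meet_iff, THEN conjunct2, THEN conjunct2, THEN conjunct2]
  show ?thesis
    using bspec[OF bspec[OF meet assms(2)] assms(3)] by (elim bexE) (rule that, auto)
qed

text \<open>The diagonal x to \<open>m (x, x)\<close> followed by the action of \<open>m\<close> on
  \<alpha> and \<beta>. The diagonal is available at x because a partial function of
  \<open>D\<close> is defined only on the carrier.\<close>

lemma pfuns_pair:
  assumes D: "is_dco D" and m: "is_meet D m" and "\<alpha> \<in> pfuns D" "\<beta> \<in> pfuns D"
  obtains \<gamma> where "\<gamma> \<in> pfuns D"
    "\<And>x y z. \<alpha> x = Some y \<Longrightarrow> \<beta> x = Some z \<Longrightarrow> \<gamma> x = Some (m (y, z))"
proof -
  obtain \<delta> where \<delta>: "\<delta> \<in> pfuns D" "\<And>a. a \<in> carrier D \<Longrightarrow> \<delta> a = Some (m (a, a))"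
    using meet_diag[OF m] by blast
  obtain \<pi> where \<pi>: "\<pi> \<in> pfuns D"
      "\<And>a b a' b'. \<alpha> a = Some a' \<Longrightarrow> \<beta> b = Some b' \<Longrightarrow> \<pi> (m (a, b)) = Some (m (a', b'))"
    by (rule meet_map[OF m assms(3,4)]) blast
  obtain \<gamma> where \<gamma>: "\<gamma> \<in> pfuns D" "\<And>x y z. \<delta> x = Some y \<Longrightarrow> \<pi> y = Some z \<Longrightarrow> \<gamma> x = Some z"
    using pfuns_comp[OF D \<delta>(1) \<pi>(1)] by blast
  show ?thesis
  proof (rule that[OF \<gamma>(1)])
    fix x y z assume yz: "\<alpha> x = Some y" "\<beta> x = Some z"
    have "\<delta> x = Some (m (x, x))" using \<delta>(2)[OF pfuns_closed(1)[OF D assms(3) yz(1)]] .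
    then show "\<gamma> x = Some (m (y, z))" by (rule \<gamma>(2)) (rule \<pi>(2)[OF yz])
  qed
qed

text \<open>Shallowness alone moves a given a to c by a function that may depend on a. Passing
  through the top element first removes this dependence: one function sends everything to
  \<open>t ()\<close>, and one more sends \<open>t ()\<close> to c.\<close>

lemma pfuns_const:
  assumes D: "is_dco D" and t: "is_top D t" and S: "shallow D" and c: "c \<in> carrier D"
  obtains \<kappa> where "\<kappa> \<in> pfuns D" "\<And>a. a \<in> carrier D \<Longrightarrow> \<kappa> a = Some c"
proof -
  obtain \<tau> where \<tau>: "t () \<in> carrier D" "\<tau> \<in> pfuns D" "\<forall>a\<in>carrier D. \<tau> a = Some (t ())"
    using t unfolding is_top_iff[OF D] by blast
  obtain \<alpha> where \<alpha>: "\<alpha> \<in> pfuns D" "\<alpha> (t ()) = Some c"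
    using S c \<tau>(1) unfolding shallow_def by blast
  from pfuns_comp[OF D \<tau>(2) \<alpha>(1)] show ?thesis
    using \<tau>(3) \<alpha>(2) that by metis
qed

section \<open>The DCO induced by a PCA\<close>

lemma app_closed:
  assumes "is_pca P" "a \<in> pcarrier P" "b \<in> pcarrier P" "app P a b = Some c"
  shows "c \<in> pcarrier P"
  using assms unfolding is_pca_def is_pas_def by blast

lemma pca_represent:
  assumes "is_pca P" "is_polynomial P (n + 1) t"
  obtains e where "e \<in> pcarrier P"
    "\<And>as. length as = n + 1 \<Longrightarrow> set as \<subseteq> pcarrier P \<Longrightarrow>
       app_list P e (take n as) \<noteq> None \<and> term_value P as t \<preceq> app_list P e as"
  using assms unfolding is_pca_def by blast

lemma pca_represent1:
  assumes P: "is_pca P" and t: "is_polynomial P 1 t"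
  obtains e where "e \<in> pcarrier P"
    "\<And>a b. a \<in> pcarrier P \<Longrightarrow> term_value P [a] t = Some b \<Longrightarrow> app P e a = Some b"
proof -
  obtain e where e: "e \<in> pcarrier P"
    "\<And>as. length as = 0 + 1 \<Longrightarrow> set as \<subseteq> pcarrier P \<Longrightarrow>
       app_list P e (take 0 as) \<noteq> None \<and> term_value P as t \<preceq> app_list P e as"
    using pca_represent[OF P, of 0 t] t by (metis add_0)
  show ?thesis
    by (rule that[OF e(1)]) (use e(2)[of "[_]"] in \<open>auto simp: app_list_def def_le_def\<close>)
qed

text \<open>With two variables the definedness clause concerns e a, so the partial application is an
  honest element u. This is what later makes transposes total.\<close>

lemma pca_represent2:
  assumes P: "is_pca P" and t: "is_polynomial P 2 t"
  obtains e where "e \<in> pcarrier P"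
    "\<And>a b. a \<in> pcarrier P \<Longrightarrow> b \<in> pcarrier P \<Longrightarrow>
       \<exists>u\<in>pcarrier P. app P e a = Some u \<and> term_value P [a, b] t \<preceq> app P u b"
proof -
  obtain e where e: "e \<in> pcarrier P"
    "\<And>as. length as = 1 + 1 \<Longrightarrow> set as \<subseteq> pcarrier P \<Longrightarrow>
       app_list P e (take 1 as) \<noteq> None \<and> term_value P as t \<preceq> app_list P e as"
    using pca_represent[OF P, of 1 t] t by (metis one_add_one)
  show ?thesis
  proof (rule that[OF e(1)])
    fix a b assume ab: "a \<in> pcarrier P" "b \<in> pcarrier P"
    from e(2)[of "[a, b]"] ab obtain u where u: "app P e a = Some u"
      by (auto simp: app_list_def)
    with e(2)[of "[a, b]"] ab app_closed[OF P e(1) ab(1) u]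
    show "\<exists>u\<in>pcarrier P. app P e a = Some u \<and> term_value P [a, b] t \<preceq> app P u b"
      by (auto simp: app_list_def)
  qed
qed

text \<open>Church pairing: the pair of a and b is the function sending z to z a b, and a projection
  feeds it the selector of the first or second argument.\<close>

lemma pca_pairing:
  assumes P: "is_pca P"
  obtains pr p q where "pr \<in> pcarrier P" "p \<in> pcarrier P" "q \<in> pcarrier P"
    "\<And>a b. a \<in> pcarrier P \<Longrightarrow> b \<in> pcarrier P \<Longrightarrow>
       \<exists>u v. app P pr a = Some u \<and> app P u b = Some v \<and> u \<in> pcarrier P \<and> v \<in> pcarrier P \<and>
         app P p v = Some a \<and> app P q v = Some b"
proof -
  let ?C = "pcarrier P"
  \<comment> \<open>\<open>k\<close> and \<open>l\<close> are the two selectors, k a b = a and l a b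
    = b.\<close>
  obtain k where k: "k \<in> ?C" "\<And>a b. a \<in> ?C \<Longrightarrow> b \<in> ?C \<Longrightarrow>
       \<exists>u\<in>?C. app P k a = Some u \<and> app P u b = Some a"
    using pca_represent2[OF P, of "Var 0"] by (auto simp: is_polynomial_def def_le_def) metis
  obtain l where l: "l \<in> ?C" "\<And>a b. a \<in> ?C \<Longrightarrow> b \<in> ?C \<Longrightarrow>
       \<exists>u\<in>?C. app P l a = Some u \<and> app P u b = Some b"
    using pca_represent2[OF P, of "Var 1"] by (auto simp: is_polynomial_def def_le_def) metis
  obtain p where p: "p \<in> ?C"
      "\<And>a b. a \<in> ?C \<Longrightarrow> app P a k = Some b \<Longrightarrow> app P p a = Some b"
    using pca_represent1[OF P, of "App (Var 0) (Const k)"] k(1)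
    by (auto simp: is_polynomial_def)
  obtain q where q: "q \<in> ?C"
      "\<And>a b. a \<in> ?C \<Longrightarrow> app P a l = Some b \<Longrightarrow> app P q a = Some b"
    using pca_represent1[OF P, of "App (Var 0) (Const l)"] l(1)
    by (auto simp: is_polynomial_def)
  \<comment> \<open>The selector is the last of three variables, so that the definedness clause
    speaks about pr a b, that is, about the pair itself.\<close>
  let ?t = "App (App (Var 2) (Var 0)) (Var 1)"
  have "is_polynomial P (2 + 1) ?t" by (auto simp: is_polynomial_def)
  then obtain pr where pr: "pr \<in> ?C"
    "\<And>as. length as = 2 + 1 \<Longrightarrow> set as \<subseteq> ?C \<Longrightarrow>
       app_list P pr (take 2 as) \<noteq> None \<and> term_value P as ?t \<preceq> app_list P pr as"
    using pca_represent[OF P] by blast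
  have "\<exists>u v. app P pr a = Some u \<and> app P u b = Some v \<and> u \<in> ?C \<and> v \<in> ?C \<and>
         app P p v = Some a \<and> app P q v = Some b" if ab: "a \<in> ?C" "b \<in> ?C" for a b
  proof -
    \<comment> \<open>The third entry \<open>k\<close> only fills the list; definedness of pr a b is
      read off from \<open>take 2\<close>.\<close>
    obtain u v where uv: "app P pr a = Some u" "app P u b = Some v"
      using pr(2)[of "[a, b, k]"] ab k(1) by (auto simp: app_list_def bind_eq_Some_conv)
    have u: "u \<in> ?C" using app_closed[OF P pr(1) ab(1) uv(1)] .
    have v: "v \<in> ?C" using app_closed[OF P u ab(2) uv(2)] .
    have "app P v k = Some a"
      using pr(2)[of "[a, b, k]"] ab k(1) k(2)[OF ab] uv
      by (auto simp: app_list_def def_le_def)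
    moreover have "app P v l = Some b"
      using pr(2)[of "[a, b, l]"] ab l(1) l(2)[OF ab] uv
      by (auto simp: app_list_def def_le_def)
    ultimately show ?thesis using p(2) q(2) u v uv by blast
  qed
  with pr(1) p(1) q(1) show ?thesis by (rule that)
qed

section \<open>Polynomials as partial functions of the induced DCO, and its structure\<close>

lemma induced_dco_sel:
  "carrier (induced_dco P) = pcarrier P"
  "\<phi> \<in> pfuns (induced_dco P) \<longleftrightarrow> (\<exists>a\<in>pcarrier P. \<phi> = app P a |` pcarrier P)"
  by (auto simp: induced_dco_def)

lemma induced_dco_represent:
  assumes P: "is_pca P" and t: "is_polynomial P 1 t"
  obtains \<phi> where "\<phi> \<in> pfuns (induced_dco P)"
    "\<And>a b. a \<in> pcarrier P \<Longrightarrow> term_value P [a] t = Some b \<Longrightarrow> \<phi> a = Some b"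
  using pca_represent1[OF P t] induced_dco_sel(2) by (metis restrict_in)

lemma is_dco_induced:
  assumes P: "is_pca P"
  shows "is_dco (induced_dco P)"
proof -
  let ?C = "pcarrier P" and ?E = "induced_dco P"
  have "dom \<alpha> \<subseteq> carrier ?E \<and> ran \<alpha> \<subseteq> carrier ?E" if "\<alpha> \<in> pfuns ?E" for \<alpha>
  proof -
    obtain a where a: "a \<in> ?C" "\<alpha> = app P a |` ?C" using \<open>\<alpha> \<in> pfuns ?E\<close> induced_dco_sel(2) by metis
    then show ?thesis
      using app_closed[OF P a(1)] by (auto simp: induced_dco_sel ran_def restrict_map_def split: if_splits)
  qed
  moreover have "Some |` carrier ?E \<in> pfuns ?E"
  proof -
    obtain e where e: "e \<in> ?C" "\<And>a. a \<in> ?C \<Longrightarrow> app P e a = Some a"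
      using pca_represent1[OF P, of "Var 0"] by (auto simp: is_polynomial_def) metis
    \<comment> \<open>The identity itself must belong to \<open>pfuns\<close>, not just an extension
      of it. As e a = a holds on the whole carrier, the restriction leaves no room for a proper
      extension.\<close>
    then have "Some |` ?C = app P e |` ?C" by (auto simp: restrict_map_def)
    then show ?thesis unfolding induced_dco_sel using e(1) by blast
  qed
  moreover have "\<exists>\<gamma>\<in>pfuns ?E. \<beta> \<circ>\<^sub>m \<alpha> \<subseteq>\<^sub>m \<gamma>" if ab: "\<alpha> \<in> pfuns ?E" "\<beta> \<in> pfuns ?E" for \<alpha> \<beta>
  proof -
    obtain a where a: "a \<in> ?C" "\<alpha> = app P a |` ?C" using ab(1) induced_dco_sel(2) by metis
    obtain b where b: "b \<in> ?C" "\<beta> = app P b |` ?C" using ab(2) induced_dco_sel(2) by metis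
    let ?t = "App (Const b) (App (Const a) (Var 0))"
    have t: "is_polynomial P 1 ?t" using a(1) b(1) by (auto simp: is_polynomial_def)
    obtain \<gamma> where \<gamma>: "\<gamma> \<in> pfuns ?E"
        "\<And>x z. x \<in> ?C \<Longrightarrow> term_value P [x] ?t = Some z \<Longrightarrow> \<gamma> x = Some z"
      by (rule induced_dco_represent[OF P t]) blast
    have "\<beta> \<circ>\<^sub>m \<alpha> \<subseteq>\<^sub>m \<gamma>"
      unfolding map_le_def
    proof
      fix x assume "x \<in> dom (\<beta> \<circ>\<^sub>m \<alpha>)"
      then obtain z where z: "(\<beta> \<circ>\<^sub>m \<alpha>) x = Some z" by blast
      then have "x \<in> ?C \<and> term_value P [x] ?t = Some z"
        unfolding a(2) b(2) by (auto simp: map_comp_def restrict_map_def split: option.splits if_splits)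
      with \<gamma>(2) z show "(\<beta> \<circ>\<^sub>m \<alpha>) x = \<gamma> x" by simp
    qed
    with \<gamma>(1) show ?thesis by blast
  qed
  ultimately show ?thesis unfolding is_dco_def by blast
qed

lemma induced_dco_const:
  assumes P: "is_pca P" and c: "c \<in> pcarrier P"
  shows "\<exists>\<phi>\<in>pfuns (induced_dco P). \<forall>a\<in>pcarrier P. \<phi> a = Some c"
proof -
  have t: "is_polynomial P 1 (Const c)" using c by (simp add: is_polynomial_def)
  show ?thesis by (rule induced_dco_represent[OF P t]) auto
qed

lemma shallow_induced:
  assumes P: "is_pca P"
  shows "shallow (induced_dco P)"
proof -
  \<comment> \<open>Representing elements exist for every polynomial, so the carrier of a PCA is
    inhabited; here \<open>pr\<close> is such an element.\<close>
  have "pcarrier P \<noteq> {}" using pca_pairing[OF P] by blast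
  then show ?thesis
    unfolding shallow_def induced_dco_sel(1) using induced_dco_const[OF P] by meson
qed

lemma is_top_induced:
  assumes P: "is_pca P"
  shows "\<exists>t. is_top (induced_dco P) t"
proof -
  obtain c where c: "c \<in> pcarrier P" using pca_pairing[OF P] by blast
  then have "is_top (induced_dco P) (\<lambda>_. c)"
    unfolding is_top_iff[OF is_dco_induced[OF P]] induced_dco_sel(1)
    using induced_dco_const[OF P] by simp
  then show ?thesis by blast
qed

text \<open>The meet is the pairing, \<open>ap\<close> represents (p x)(q x), and the transpose of
  the function represented by c is the one represented by e, where e represents c (pr x y) in the
  two variables x and y.\<close>

lemma functionally_complete_induced:
  assumes P: "is_pca P"
  shows "\<exists>m. is_meet (induced_dco P) m \<and> functionally_complete_wrt (induced_dco P) m"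
proof -
  let ?C = "pcarrier P" and ?E = "induced_dco P"
  obtain pr p q where prpq: "pr \<in> ?C" "p \<in> ?C" "q \<in> ?C"
    "\<And>a b. a \<in> ?C \<Longrightarrow> b \<in> ?C \<Longrightarrow>
       \<exists>u v. app P pr a = Some u \<and> app P u b = Some v \<and> u \<in> ?C \<and> v \<in> ?C \<and>
         app P p v = Some a \<and> app P q v = Some b"
    using pca_pairing[OF P] by blast
  \<comment> \<open>Both occurrences of \<open>the\<close> are harmless on the carrier, where pr a b
    is always defined.\<close>
  define m where "m = (\<lambda>(a, b). the (app P (the (app P pr a)) b))"
  have m: "m (a, b) \<in> ?C" "app P p (m (a, b)) = Some a" "app P q (m (a, b)) = Some b"
    "Option.bind (app P pr a) (\<lambda>u. app P u b) = Some (m (a, b))"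
    if "a \<in> ?C" "b \<in> ?C" for a b
    using prpq(4)[OF that] by (auto simp: m_def)
  have meet: "is_meet ?E m"
    unfolding is_meet_iff induced_dco_sel(1)
  proof (intro conjI ballI)
    fix a b assume "a \<in> ?C" "b \<in> ?C"
    then show "m (a, b) \<in> ?C" by (rule m(1))
  next
    let ?t = "App (App (Const pr) (Var 0)) (Var 0)"
    have t: "is_polynomial P 1 ?t" using prpq(1) by (auto simp: is_polynomial_def)
    show "\<exists>\<delta>\<in>pfuns ?E. \<forall>a\<in>?C. \<delta> a = Some (m (a, a))"
      by (rule induced_dco_represent[OF P t]) (use m(4) in auto)
  next
    have pq: "app P p |` ?C \<in> pfuns ?E" "app P q |` ?C \<in> pfuns ?E"
      unfolding induced_dco_sel(2) using prpq(2,3) by blast+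
    show "\<exists>p\<in>pfuns ?E. \<exists>q\<in>pfuns ?E. \<forall>a\<in>?C. \<forall>b\<in>?C.
        p (m (a, b)) = Some a \<and> q (m (a, b)) = Some b"
      by (rule bexI[OF bexI[OF _ pq(2)] pq(1)]) (simp add: m)
  next
    fix \<alpha> \<beta> assume ab: "\<alpha> \<in> pfuns ?E" "\<beta> \<in> pfuns ?E"
    obtain a where a: "a \<in> ?C" "\<alpha> = app P a |` ?C" using ab(1) induced_dco_sel(2) by metis
    obtain b where b: "b \<in> ?C" "\<beta> = app P b |` ?C" using ab(2) induced_dco_sel(2) by metis
    \<comment> \<open>Unpack the pair, act by a and b on the components, and pack again: pr (a (p
      x)) (b (q x)).\<close>
    let ?t = "App (App (Const pr) (App (Const a) (App (Const p) (Var 0))))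
                (App (Const b) (App (Const q) (Var 0)))"
    have t: "is_polynomial P 1 ?t"
      using prpq(1-3) a(1) b(1) by (auto simp: is_polynomial_def)
    obtain \<gamma> where \<gamma>: "\<gamma> \<in> pfuns ?E"
        "\<And>x z. x \<in> ?C \<Longrightarrow> term_value P [x] ?t = Some z \<Longrightarrow> \<gamma> x = Some z"
      by (rule induced_dco_represent[OF P t]) blast
    have "\<gamma> (m (x, y)) = Some (m (x', y'))" if xy: "\<alpha> x = Some x'" "\<beta> y = Some y'" for x y x' y'
    proof -
      have C: "x \<in> ?C" "y \<in> ?C" "x' \<in> ?C" "y' \<in> ?C"
        using pfuns_closed[OF is_dco_induced[OF P]] ab xy unfolding induced_dco_sel(1) by blast+
      have "app P a x = Some x'" "app P b y = Some y'"
        using xy C unfolding a(2) b(2) by simp_all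
      then show ?thesis
        using \<gamma>(2)[OF m(1)[OF C(1,2)]] m[OF C(1,2)] m(4)[OF C(3,4)] by simp
    qed
    with \<gamma>(1) show "\<exists>\<gamma>\<in>pfuns ?E. \<forall>x y x' y'. \<alpha> x = Some x' \<longrightarrow> \<beta> y = Some y' \<longrightarrow>
        \<gamma> (m (x, y)) = Some (m (x', y'))" by blast
  qed
  have "functionally_complete_wrt ?E m"
  proof -
    let ?t = "App (App (Const p) (Var 0)) (App (Const q) (Var 0))"
    have t: "is_polynomial P 1 ?t" using prpq(2,3) by (auto simp: is_polynomial_def)
    obtain ap where ap: "ap \<in> pfuns ?E"
        "\<And>x z. x \<in> ?C \<Longrightarrow> term_value P [x] ?t = Some z \<Longrightarrow> ap x = Some z"
      by (rule induced_dco_represent[OF P t]) blast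
    have "\<exists>\<alpha>'\<in>pfuns ?E. dom \<alpha>' = ?C \<and> (\<forall>a\<in>?C. \<forall>b\<in>?C.
           \<alpha> (m (a, b)) \<preceq> Option.bind (\<alpha>' a) (\<lambda>c. ap (m (c, b))))"
      if \<alpha>: "\<alpha> \<in> pfuns ?E" for \<alpha>
    proof -
      obtain c where c: "c \<in> ?C" "\<alpha> = app P c |` ?C" using \<alpha> induced_dco_sel(2) by metis
      let ?s = "App (Const c) (App (App (Const pr) (Var 0)) (Var 1))"
      have s: "is_polynomial P 2 ?s" using prpq(1) c(1) by (auto simp: is_polynomial_def)
      obtain e where e: "e \<in> ?C" "\<And>a b. a \<in> ?C \<Longrightarrow> b \<in> ?C \<Longrightarrow>
          \<exists>u\<in>?C. app P e a = Some u \<and> term_value P [a, b] ?s \<preceq> app P u b"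
        by (rule pca_represent2[OF P s]) blast
      let ?\<alpha>' = "app P e |` ?C"
      have "?\<alpha>' \<in> pfuns ?E" unfolding induced_dco_sel(2) using e(1) by blast
      \<comment> \<open>Totality is the definedness of e a, granted whether or not the polynomial
        has a value.\<close>
      moreover have "dom ?\<alpha>' = ?C" using e(2) by (fastforce simp: restrict_map_def split: if_splits)
      moreover have "\<alpha> (m (a, b)) \<preceq> Option.bind (?\<alpha>' a) (\<lambda>c. ap (m (c, b)))"
        if ab: "a \<in> ?C" "b \<in> ?C" for a b
      proof (cases "\<alpha> (m (a, b))")
        case None
        then show ?thesis by (simp add: def_le_def)
      next
        case (Some x)
        then have "app P c (m (a, b)) = Some x" using c(2) m(1)[OF ab] by simp
        then have "term_value P [a, b] ?s = Some x" using m(4)[OF ab] by simp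
        with e(2)[OF ab] obtain u where u: "u \<in> ?C" "app P e a = Some u" "app P u b = Some x"
          by (metis def_le_def option.distinct(1))
        then have "ap (m (u, b)) = Some x"
          using ap(2)[OF m(1)[OF u(1) ab(2)]] m[OF u(1) ab(2)] by simp
        with u Some ab show ?thesis by (simp add: def_le_def)
      qed
      ultimately show ?thesis by blast
    qed
    with ap(1) show ?thesis
      unfolding functionally_complete_wrt_def induced_dco_sel(1) by blast
  qed
  with meet show ?thesis by blast
qed

section \<open>Invariance under isomorphism\<close>

text \<open>Each witness for \<open>E\<close> is pulled back along \<open>g\<close>, after the
  partial functions of \<open>D\<close> occurring in the property have been pushed forward along
  \<open>f\<close>. Since \<open>f\<close> and \<open>g\<close> are mutually inverse on the
  carriers, the pulled-back witness takes the right values in \<open>D\<close>.\<close>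

lemma cartesian_shallow_complete_iso:
  assumes D: "is_dco D" and E: "is_dco E" and iso: "dco_isomorphic D E"
    and S: "shallow E" and top: "\<exists>t. is_top E t"
    and fc: "\<exists>m. is_meet E m \<and> functionally_complete_wrt E m"
  shows "cartesian D \<and> shallow D \<and> functionally_complete D"
proof -
  obtain f g where f: "dco_mor D E f" and g: "dco_mor E D g"
    and gf: "\<And>a. a \<in> carrier D \<Longrightarrow> g (f a) = a" and fg: "\<And>b. b \<in> carrier E \<Longrightarrow> f (g b) = b"
    using iso unfolding dco_isomorphic_def by blast
  have fC: "f a \<in> carrier E" if "a \<in> carrier D" for a using f that unfolding dco_mor_iff by blast
  have gC: "g b \<in> carrier D" if "b \<in> carrier E" for b using g that unfolding dco_mor_iff by blast
  have push: "\<exists>\<beta>\<in>pfuns E. \<forall>x y. \<alpha> x = Some y \<longrightarrow> \<beta> (f x) = Some (f y)" if "\<alpha> \<in> pfuns D" for \<alpha>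
    using f that unfolding dco_mor_iff by blast
  have pull: "\<exists>\<alpha>\<in>pfuns D. \<forall>x y. \<beta> x = Some y \<longrightarrow> \<alpha> (g x) = Some (g y)" if "\<beta> \<in> pfuns E" for \<beta>
    using g that unfolding dco_mor_iff by blast
  have shallow: "shallow D"
    unfolding shallow_def
  proof (intro conjI ballI)
    show "carrier D \<noteq> {}" using S gC unfolding shallow_def by blast
  next
    fix a b assume ab: "a \<in> carrier D" "b \<in> carrier D"
    then obtain \<beta> where "\<beta> \<in> pfuns E" "\<beta> (f a) = Some (f b)"
      using S fC unfolding shallow_def by blast
    with pull gf ab show "\<exists>\<alpha>\<in>pfuns D. \<alpha> a = Some b" by metis
  qed
  obtain t where t: "is_top E t" using top ..
  then obtain \<tau> where \<tau>: "t () \<in> carrier E" "\<tau> \<in> pfuns E" "\<forall>a\<in>carrier E. \<tau> a = Some (t ())"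
    unfolding is_top_iff[OF E] by blast
  obtain \<tau>' where \<tau>': "\<tau>' \<in> pfuns D" "\<And>x y. \<tau> x = Some y \<Longrightarrow> \<tau>' (g x) = Some (g y)"
    using pull[OF \<tau>(2)] by blast
  have "\<tau>' a = Some (g (t ()))" if "a \<in> carrier D" for a
    using \<tau>'(2) \<tau>(3) fC gf that by metis
  then have topD: "is_top D (g \<circ> t)"
    unfolding is_top_iff[OF D] using \<tau>'(1) gC[OF \<tau>(1)] by auto
  obtain m where m: "is_meet E m" "functionally_complete_wrt E m" using fc by blast
  \<comment> \<open>The transported meet. It satisfies f (n (a, b)) = m (f a, f b) on the carrier,
    which is how statements about \<open>n\<close> reduce to statements about
    \<open>m\<close>.\<close>
  define n where "n = (\<lambda>(a, b). g (m (f a, f b)))"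
  have mC: "m (a, b) \<in> carrier E" if "a \<in> carrier E" "b \<in> carrier E" for a b
    using meet_closed[OF m(1) that] .
  have meet: "is_meet D n"
    unfolding is_meet_iff
  proof (intro conjI ballI)
    fix a b assume "a \<in> carrier D" "b \<in> carrier D"
    then show "n (a, b) \<in> carrier D" using mC fC gC by (simp add: n_def)
  next
    obtain \<delta> where \<delta>: "\<delta> \<in> pfuns E" "\<And>a. a \<in> carrier E \<Longrightarrow> \<delta> a = Some (m (a, a))"
      using meet_diag[OF m(1)] by blast
    obtain \<delta>' where \<delta>': "\<delta>' \<in> pfuns D" "\<And>x y. \<delta> x = Some y \<Longrightarrow> \<delta>' (g x) = Some (g y)"
      using pull[OF \<delta>(1)] by blast
    have "\<delta>' a = Some (n (a, a))" if "a \<in> carrier D" for a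
      using \<delta>'(2)[of "f a"] \<delta>(2) fC[OF that] gf[OF that] by (simp add: n_def)
    with \<delta>'(1) show "\<exists>\<delta>\<in>pfuns D. \<forall>a\<in>carrier D. \<delta> a = Some (n (a, a))" by blast
  next
    obtain p q where pq: "p \<in> pfuns E" "q \<in> pfuns E"
        "\<And>a b. a \<in> carrier E \<Longrightarrow> b \<in> carrier E \<Longrightarrow> p (m (a, b)) = Some a"
        "\<And>a b. a \<in> carrier E \<Longrightarrow> b \<in> carrier E \<Longrightarrow> q (m (a, b)) = Some b"
      by (rule meet_proj[OF m(1)]) blast
    obtain p' where p': "p' \<in> pfuns D" "\<And>x y. p x = Some y \<Longrightarrow> p' (g x) = Some (g y)"
      using pull[OF pq(1)] by blast
    obtain q' where q': "q' \<in> pfuns D" "\<And>x y. q x = Some y \<Longrightarrow> q' (g x) = Some (g y)"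
      using pull[OF pq(2)] by blast
    have "p' (n (a, b)) = Some a \<and> q' (n (a, b)) = Some b"
      if "a \<in> carrier D" "b \<in> carrier D" for a b
      using p'(2)[of "m (f a, f b)"] q'(2)[of "m (f a, f b)"] pq(3,4) that fC gf by (simp add: n_def)
    with p'(1) q'(1) show "\<exists>p\<in>pfuns D. \<exists>q\<in>pfuns D. \<forall>a\<in>carrier D. \<forall>b\<in>carrier D.
        p (n (a, b)) = Some a \<and> q (n (a, b)) = Some b" by blast
  next
    fix \<alpha> \<beta> assume ab: "\<alpha> \<in> pfuns D" "\<beta> \<in> pfuns D"
    obtain \<alpha>' where \<alpha>': "\<alpha>' \<in> pfuns E" "\<And>x y. \<alpha> x = Some y \<Longrightarrow> \<alpha>' (f x) = Some (f y)"
      using push[OF ab(1)] by blast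
    obtain \<beta>' where \<beta>': "\<beta>' \<in> pfuns E" "\<And>x y. \<beta> x = Some y \<Longrightarrow> \<beta>' (f x) = Some (f y)"
      using push[OF ab(2)] by blast
    obtain \<gamma> where \<gamma>: "\<gamma> \<in> pfuns E"
        "\<And>a b a' b'. \<alpha>' a = Some a' \<Longrightarrow> \<beta>' b = Some b' \<Longrightarrow> \<gamma> (m (a, b)) = Some (m (a', b'))"
      by (rule meet_map[OF m(1) \<alpha>'(1) \<beta>'(1)]) blast
    obtain \<gamma>' where \<gamma>': "\<gamma>' \<in> pfuns D" "\<And>x y. \<gamma> x = Some y \<Longrightarrow> \<gamma>' (g x) = Some (g y)"
      using pull[OF \<gamma>(1)] by blast
    have "\<gamma>' (n (a, b)) = Some (n (a', b'))" if "\<alpha> a = Some a'" "\<beta> b = Some b'" for a b a' b'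
      using \<gamma>'(2) \<gamma>(2) \<alpha>'(2) \<beta>'(2) that by (simp add: n_def)
    with \<gamma>'(1) show "\<exists>\<gamma>\<in>pfuns D. \<forall>a b a' b'. \<alpha> a = Some a' \<longrightarrow> \<beta> b = Some b' \<longrightarrow>
        \<gamma> (n (a, b)) = Some (n (a', b'))" by blast
  qed
  obtain ap where ap: "ap \<in> pfuns E"
      "\<And>\<alpha>. \<alpha> \<in> pfuns E \<Longrightarrow> \<exists>\<alpha>'\<in>pfuns E. dom \<alpha>' = carrier E \<and>
        (\<forall>a\<in>carrier E. \<forall>b\<in>carrier E. \<alpha> (m (a, b)) \<preceq> Option.bind (\<alpha>' a) (\<lambda>c. ap (m (c, b))))"
    using m(2) unfolding functionally_complete_wrt_def by blast
  obtain ap' where ap': "ap' \<in> pfuns D" "\<And>x y. ap x = Some y \<Longrightarrow> ap' (g x) = Some (g y)"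
    using pull[OF ap(1)] by blast
  have "\<exists>\<alpha>'\<in>pfuns D. dom \<alpha>' = carrier D \<and>
        (\<forall>a\<in>carrier D. \<forall>b\<in>carrier D. \<alpha> (n (a, b)) \<preceq> Option.bind (\<alpha>' a) (\<lambda>c. ap' (n (c, b))))"
    if \<alpha>: "\<alpha> \<in> pfuns D" for \<alpha>
  proof -
    obtain \<beta> where \<beta>: "\<beta> \<in> pfuns E" "\<And>x y. \<alpha> x = Some y \<Longrightarrow> \<beta> (f x) = Some (f y)"
      using push[OF \<alpha>] by blast
    obtain \<beta>' where \<beta>': "\<beta>' \<in> pfuns E" "dom \<beta>' = carrier E"
        "\<And>a b. a \<in> carrier E \<Longrightarrow> b \<in> carrier E \<Longrightarrow>
          \<beta> (m (a, b)) \<preceq> Option.bind (\<beta>' a) (\<lambda>c. ap (m (c, b)))"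
      using ap(2)[OF \<beta>(1)] by blast
    obtain \<alpha>' where \<alpha>': "\<alpha>' \<in> pfuns D" "\<And>x y. \<beta>' x = Some y \<Longrightarrow> \<alpha>' (g x) = Some (g y)"
      using pull[OF \<beta>'(1)] by blast
    \<comment> \<open>The pulled-back function extends the transported transpose, so it is defined
      wherever that one is; totality of \<beta>' therefore passes to \<alpha>'.\<close>
    have val: "\<exists>c. \<beta>' (f a) = Some c \<and> \<alpha>' a = Some (g c)" if a: "a \<in> carrier D" for a
    proof -
      obtain c where "\<beta>' (f a) = Some c" using \<beta>'(2) fC[OF a] by blast
      with \<alpha>'(2)[OF this] gf[OF a] show ?thesis by simp
    qed
    have "dom \<alpha>' = carrier D" using val pfuns_closed(1)[OF D \<alpha>'(1)] by blast
    moreover have "\<alpha> (n (a, b)) \<preceq> Option.bind (\<alpha>' a) (\<lambda>c. ap' (n (c, b)))"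
      if ab: "a \<in> carrier D" "b \<in> carrier D" for a b
    proof (cases "\<alpha> (n (a, b))")
      case None
      then show ?thesis by (simp add: def_le_def)
    next
      case (Some x)
      have x: "x \<in> carrier D" using pfuns_closed(2)[OF D \<alpha> Some] .
      obtain c where c: "\<beta>' (f a) = Some c" "\<alpha>' a = Some (g c)" using val[OF ab(1)] by blast
      have cC: "c \<in> carrier E" using pfuns_closed(2)[OF E \<beta>'(1) c(1)] .
      have "\<beta> (m (f a, f b)) = Some (f x)"
        using \<beta>(2)[OF Some] fg mC fC ab by (simp add: n_def)
      then have "ap (m (c, f b)) = Some (f x)"
        using \<beta>'(3)[of "f a" "f b"] fC ab c(1) by (simp add: def_le_def)
      then have "ap' (n (g c, b)) = Some x"
        using ap'(2) fg[OF cC] gf[OF x] by (auto simp: n_def)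
      with c(2) Some show ?thesis by (simp add: def_le_def)
    qed
    ultimately show ?thesis using \<alpha>'(1) by blast
  qed
  with ap'(1) have "functionally_complete_wrt D n"
    unfolding functionally_complete_wrt_def by blast
  with shallow topD meet show ?thesis
    unfolding functionally_complete_def cartesian_def by blast
qed

lemma pca_iso_imp:
  assumes "is_dco D" "is_pca P" "dco_isomorphic D (induced_dco P)"
  shows "cartesian D \<and> shallow D \<and> functionally_complete D"
  using cartesian_shallow_complete_iso[OF assms(1) is_dco_induced[OF assms(2)] assms(3)]
    shallow_induced is_top_induced functionally_complete_induced assms(2) by blast

section \<open>The PCA of a functionally complete shallow DCO\<close>

lemma foldl_meet_closed:
  assumes "is_meet D m"
  shows "x \<in> carrier D \<Longrightarrow> set as \<subseteq> carrier D \<Longrightarrow> foldl (curry m) x as \<in> carrier D"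
  using assms by (induction as arbitrary: x) (auto simp: meet_closed)

text \<open>Codes nest to the left: the last entry is one \<open>q\<close> away, and
  \<open>p\<close> strips it off, leaving the code of a list shorter by one. The resulting
  projection depends on i and on the length k, but not on the list.\<close>

lemma pfuns_nth:
  assumes D: "is_dco D" and m: "is_meet D m" and x: "x \<in> carrier D"
  shows "i < k \<Longrightarrow> \<exists>\<pi>\<in>pfuns D. \<forall>as. length as = k \<longrightarrow> set as \<subseteq> carrier D \<longrightarrow>
    \<pi> (foldl (curry m) x as) = Some (as ! i)"
proof (induction k)
  case (Suc k)
  obtain p q where pq: "p \<in> pfuns D" "q \<in> pfuns D"
      "\<And>a b. a \<in> carrier D \<Longrightarrow> b \<in> carrier D \<Longrightarrow> p (m (a, b)) = Some a"
      "\<And>a b. a \<in> carrier D \<Longrightarrow> b \<in> carrier D \<Longrightarrow> q (m (a, b)) = Some b"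
    by (rule meet_proj[OF m]) blast
  have step: "\<exists>bs b. as = bs @ [b] \<and> length bs = k \<and> set bs \<subseteq> carrier D \<and>
      p (foldl (curry m) x as) = Some (foldl (curry m) x bs) \<and> q (foldl (curry m) x as) = Some b"
    if as: "length as = Suc k" "set as \<subseteq> carrier D" for as
  proof -
    obtain bs b where bs: "as = bs @ [b]" using as(1) by (metis length_Suc_conv_rev)
    with as have "length bs = k" "set bs \<subseteq> carrier D" "b \<in> carrier D" by auto
    with pq(3,4)[OF foldl_meet_closed[OF m x]] show ?thesis by (simp add: bs)
  qed
  show ?case
  proof (cases "i = k")
    case True
    have "q (foldl (curry m) x as) = Some (as ! i)"
      if "length as = Suc k" "set as \<subseteq> carrier D" for as
      using step[OF that] True by auto
    with pq(2) show ?thesis by blast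
  next
    case False
    with Suc obtain \<pi> where \<pi>: "\<pi> \<in> pfuns D" "\<And>as. length as = k \<Longrightarrow> set as \<subseteq> carrier D \<Longrightarrow>
        \<pi> (foldl (curry m) x as) = Some (as ! i)"
      using less_antisym by metis
    obtain \<gamma> where \<gamma>: "\<gamma> \<in> pfuns D" "\<And>x y z. p x = Some y \<Longrightarrow> \<pi> y = Some z \<Longrightarrow> \<gamma> x = Some z"
      using pfuns_comp[OF D pq(1) \<pi>(1)] by blast
    have "\<gamma> (foldl (curry m) x as) = Some (as ! i)"
      if as: "length as = Suc k" "set as \<subseteq> carrier D" for as
    proof -
      obtain bs b where bs: "as = bs @ [b]" "length bs = k" "set bs \<subseteq> carrier D"
          "p (foldl (curry m) x as) = Some (foldl (curry m) x bs)"
        using step[OF as] by blast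
      have "as ! i = bs ! i" using bs(1,2) False Suc.prems by (simp add: nth_append)
      then show ?thesis using \<gamma>(2)[OF bs(4) \<pi>(2)[OF bs(2,3)]] by simp
    qed
    with \<gamma>(1) show ?thesis by blast
  qed
qed simp

definition meet_pas :: "'a dco \<Rightarrow> ('a \<times> 'a \<Rightarrow> 'a) \<Rightarrow> ('a \<rightharpoonup> 'a) \<Rightarrow> 'a pas" where
  "meet_pas D m ap = \<lparr>pcarrier = carrier D, app = (\<lambda>a b. ap (m (a, b)))\<rparr>"

lemma meet_pas_sel [simp]:
  "pcarrier (meet_pas D m ap) = carrier D"
  "app (meet_pas D m ap) a b = ap (m (a, b))"
  by (simp_all add: meet_pas_def)

text \<open>The length k is fixed through the induction, so both subterms of an application are
  evaluated at the same code; their values can then be paired and handed to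
  \<open>ap\<close>.\<close>

lemma pfuns_polynomial:
  assumes D: "is_dco D" and m: "is_meet D m" and t: "is_top D t" and S: "shallow D"
    and ap: "ap \<in> pfuns D" and x: "x \<in> carrier D"
  shows "is_polynomial (meet_pas D m ap) k s \<Longrightarrow>
    \<exists>\<sigma>\<in>pfuns D. \<forall>as. length as = k \<longrightarrow> set as \<subseteq> carrier D \<longrightarrow>
      term_value (meet_pas D m ap) as s \<preceq> \<sigma> (foldl (curry m) x as)"
proof (induction s)
  case (Var i)
  then have "i < k" by (simp add: is_polynomial_def)
  from pfuns_nth[OF D m x this] show ?case unfolding def_le_def term_value.simps by metis
next
  case (Const c)
  then have c: "c \<in> carrier D" by (simp add: is_polynomial_def)
  obtain \<kappa> where \<kappa>: "\<kappa> \<in> pfuns D" "\<And>a. a \<in> carrier D \<Longrightarrow> \<kappa> a = Some c"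
    using pfuns_const[OF D t S c] by blast
  show ?case
    by (intro bexI[OF _ \<kappa>(1)]) (simp add: \<kappa>(2)[OF foldl_meet_closed[OF m x]] def_le_def del: curry_conv)
next
  case (App r s)
  let ?P = "meet_pas D m ap"
  have "is_polynomial ?P k r" "is_polynomial ?P k s"
    using App.prems by (auto simp: is_polynomial_def)
  with App.IH obtain \<rho> \<sigma> where \<rho>: "\<rho> \<in> pfuns D" "\<And>as. length as = k \<Longrightarrow> set as \<subseteq> carrier D \<Longrightarrow>
      term_value ?P as r \<preceq> \<rho> (foldl (curry m) x as)"
    and \<sigma>: "\<sigma> \<in> pfuns D" "\<And>as. length as = k \<Longrightarrow> set as \<subseteq> carrier D \<Longrightarrow>
      term_value ?P as s \<preceq> \<sigma> (foldl (curry m) x as)"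
    by metis
  obtain \<pi> where \<pi>: "\<pi> \<in> pfuns D"
      "\<And>x y z. \<rho> x = Some y \<Longrightarrow> \<sigma> x = Some z \<Longrightarrow> \<pi> x = Some (m (y, z))"
    using pfuns_pair[OF D m \<rho>(1) \<sigma>(1)] by blast
  obtain \<gamma> where \<gamma>: "\<gamma> \<in> pfuns D" "\<And>x y z. \<pi> x = Some y \<Longrightarrow> ap y = Some z \<Longrightarrow> \<gamma> x = Some z"
    using pfuns_comp[OF D \<pi>(1) ap] by blast
  have "term_value ?P as (App r s) \<preceq> \<gamma> (foldl (curry m) x as)"
    if as: "length as = k" "set as \<subseteq> carrier D" for as
  proof (cases "term_value ?P as (App r s)")
    case None
    then show ?thesis by (simp add: def_le_def)
  next
    case (Some z)
    then obtain u v where uv: "term_value ?P as r = Some u" "term_value ?P as s = Some v"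
        "ap (m (u, v)) = Some z"
      by (auto simp: bind_eq_Some_conv)
    have "\<rho> (foldl (curry m) x as) = Some u" "\<sigma> (foldl (curry m) x as) = Some v"
      using \<rho>(2)[OF as] \<sigma>(2)[OF as] uv by (simp_all add: def_le_def)
    with \<pi>(2) \<gamma>(2) uv(3) Some show ?thesis by (simp add: def_le_def)
  qed
  with \<gamma>(1) show ?case by blast
qed

lemma app_list_snoc:
  "app_list P e (as @ [a]) = Option.bind (app_list P e as) (\<lambda>u. app P u a)"
  by (simp add: app_list_def)

text \<open>A transposition splits off the outermost meet of a code, hence the last argument. The
  function itself is therefore transposed first, and the induction hypothesis is applied to its
  transpose, which is why \<alpha> must vary. For n + 1 arguments this happens n + 1 times and
  leaves a function of the base point x alone.\<close>

lemma iterated_transpose: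
  assumes D: "is_dco D" and m: "is_meet D m"
    and transpose: "\<And>\<alpha>. \<alpha> \<in> pfuns D \<Longrightarrow> \<exists>\<alpha>'\<in>pfuns D. dom \<alpha>' = carrier D \<and>
         (\<forall>a\<in>carrier D. \<forall>b\<in>carrier D. \<alpha> (m (a, b)) \<preceq> Option.bind (\<alpha>' a) (\<lambda>c. ap (m (c, b))))"
    and "\<alpha> \<in> pfuns D"
  shows "\<exists>\<beta>\<in>pfuns D. dom \<beta> = carrier D \<and> (\<forall>x e as. \<beta> x = Some e \<longrightarrow>
    length as = Suc n \<longrightarrow> set as \<subseteq> carrier D \<longrightarrow>
      app_list (meet_pas D m ap) e (take n as) \<noteq> None \<and>
      \<alpha> (foldl (curry m) x as) \<preceq> app_list (meet_pas D m ap) e as)"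
  using \<open>\<alpha> \<in> pfuns D\<close>
proof (induction n arbitrary: \<alpha>)
  case 0
  from transpose[OF 0] obtain \<beta> where \<beta>: "\<beta> \<in> pfuns D" "dom \<beta> = carrier D"
    "\<And>a b. a \<in> carrier D \<Longrightarrow> b \<in> carrier D \<Longrightarrow>
      \<alpha> (m (a, b)) \<preceq> Option.bind (\<beta> a) (\<lambda>c. ap (m (c, b)))"
    by blast
  have "app_list (meet_pas D m ap) e (take 0 as) \<noteq> None \<and>
      \<alpha> (foldl (curry m) x as) \<preceq> app_list (meet_pas D m ap) e as"
    if "\<beta> x = Some e" "length as = Suc 0" "set as \<subseteq> carrier D" for x e as
  proof -
    obtain a where "as = [a]" using \<open>length as = Suc 0\<close> by (metis length_0_conv length_Suc_conv)
    with \<beta>(3)[of x a] that pfuns_closed(1)[OF D \<beta>(1) that(1)] show ?thesis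
      by (simp add: app_list_def)
  qed
  with \<beta>(1,2) show ?case by blast
next
  case (Suc n)
  let ?P = "meet_pas D m ap"
  from transpose[OF Suc.prems] obtain \<gamma> where \<gamma>: "\<gamma> \<in> pfuns D" "dom \<gamma> = carrier D"
    "\<And>a b. a \<in> carrier D \<Longrightarrow> b \<in> carrier D \<Longrightarrow>
      \<alpha> (m (a, b)) \<preceq> Option.bind (\<gamma> a) (\<lambda>c. ap (m (c, b)))"
    by blast
  from Suc.IH[OF \<gamma>(1)] obtain \<beta> where \<beta>: "\<beta> \<in> pfuns D" "dom \<beta> = carrier D"
    "\<And>x e as. \<beta> x = Some e \<Longrightarrow> length as = Suc n \<Longrightarrow> set as \<subseteq> carrier D \<Longrightarrow>
      \<gamma> (foldl (curry m) x as) \<preceq> app_list ?P e as"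
    by blast
  have "app_list ?P e (take (Suc n) as) \<noteq> None \<and>
      \<alpha> (foldl (curry m) x as) \<preceq> app_list ?P e as"
    if e: "\<beta> x = Some e" and as: "length as = Suc (Suc n)" "set as \<subseteq> carrier D" for x e as
  proof -
    obtain bs b where bs: "as = bs @ [b]" using as(1) by (metis length_Suc_conv_rev)
    with as have *: "length bs = Suc n" "set bs \<subseteq> carrier D" "b \<in> carrier D" by auto
    have y: "foldl (curry m) x bs \<in> carrier D"
      using foldl_meet_closed[OF m _ *(2)] pfuns_closed(1)[OF D \<beta>(1) e] .
    \<comment> \<open>Because \<gamma> is total, the comparison from the induction hypothesis
      becomes an equation: e applied to \<open>bs\<close> has the value c. This is the required
      definedness for all arguments but the last.\<close>
    then obtain c where c: "\<gamma> (foldl (curry m) x bs) = Some c" using \<gamma>(2) by blast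
    then have "app_list ?P e bs = Some c" using \<beta>(3)[OF e *(1,2)] by (simp add: def_le_def)
    with \<gamma>(3)[OF y *(3)] c *(1) show ?thesis by (simp add: bs app_list_snoc)
  qed
  with \<beta>(1,2) show ?case by blast
qed

text \<open>The PCA lives on the carrier of \<open>D\<close>, and the identity function is the
  isomorphism. It remains to compare the two families of partial functions, each being dominated by
  the other.\<close>

lemma pca_of_dco:
  fixes D :: "'a dco"
  assumes D: "is_dco D" and t: "is_top D t" and S: "shallow D"
    and m: "is_meet D m" and fc: "functionally_complete_wrt D m"
  shows "\<exists>P :: 'a pas. is_pca P \<and> dco_isomorphic D (induced_dco P)"
proof -
  obtain ap where ap: "ap \<in> pfuns D"
    and transpose: "\<And>\<alpha>. \<alpha> \<in> pfuns D \<Longrightarrow> \<exists>\<alpha>'\<in>pfuns D. dom \<alpha>' = carrier D \<and>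
         (\<forall>a\<in>carrier D. \<forall>b\<in>carrier D. \<alpha> (m (a, b)) \<preceq> Option.bind (\<alpha>' a) (\<lambda>c. ap (m (c, b))))"
    using fc unfolding functionally_complete_wrt_def by blast
  let ?P = "meet_pas D m ap" and ?x = "t ()"
  have x: "?x \<in> carrier D" using t unfolding is_top_iff[OF D] by blast
  have represent: "\<exists>e\<in>carrier D. \<forall>as. length as = Suc n \<longrightarrow> set as \<subseteq> carrier D \<longrightarrow>
      app_list ?P e (take n as) \<noteq> None \<and> \<alpha> (foldl (curry m) ?x as) \<preceq> app_list ?P e as"
    if "\<alpha> \<in> pfuns D" for \<alpha> n
  proof -
    obtain \<beta> where \<beta>: "\<beta> \<in> pfuns D" "dom \<beta> = carrier D"
        "\<And>x e as. \<beta> x = Some e \<Longrightarrow> length as = Suc n \<Longrightarrow> set as \<subseteq> carrier D \<Longrightarrow>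
          app_list ?P e (take n as) \<noteq> None \<and> \<alpha> (foldl (curry m) x as) \<preceq> app_list ?P e as"
      using iterated_transpose[OF D m transpose \<open>\<alpha> \<in> pfuns D\<close>, of n] by blast
    \<comment> \<open>The representing element is the value of the iterated transpose at the top
      element; it exists because \<beta> is total.\<close>
    obtain e where e: "\<beta> ?x = Some e" using \<beta>(2) x by blast
    with \<beta>(3)[OF e] pfuns_closed(2)[OF D \<beta>(1) e] show ?thesis by blast
  qed
  have "is_pas ?P" using pfuns_closed(2)[OF D ap] by (simp add: is_pas_def)
  moreover have "\<exists>e\<in>carrier D. \<forall>as. length as = n + 1 \<and> set as \<subseteq> carrier D \<longrightarrow>
      app_list ?P e (take n as) \<noteq> None \<and> term_value ?P as s \<preceq> app_list ?P e as"
    if s: "is_polynomial ?P (n + 1) s" for n s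
  proof -
    obtain \<sigma> where \<sigma>: "\<sigma> \<in> pfuns D" "\<And>as. length as = n + 1 \<Longrightarrow> set as \<subseteq> carrier D \<Longrightarrow>
        term_value ?P as s \<preceq> \<sigma> (foldl (curry m) ?x as)"
      using pfuns_polynomial[OF D m t S ap x s] by blast
    obtain e where e: "e \<in> carrier D" "\<And>as. length as = Suc n \<Longrightarrow> set as \<subseteq> carrier D \<Longrightarrow>
        app_list ?P e (take n as) \<noteq> None \<and> \<sigma> (foldl (curry m) ?x as) \<preceq> app_list ?P e as"
      using represent[OF \<sigma>(1)] by blast
    have "term_value ?P as s \<preceq> app_list ?P e as"
      if "length as = n + 1" "set as \<subseteq> carrier D" for as
      using \<sigma>(2)[OF that] e(2)[of as] that unfolding def_le_def by simp
    with e show ?thesis by (metis Suc_eq_plus1)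
  qed
  ultimately have pca: "is_pca ?P" unfolding is_pca_def by simp
  have "dco_mor D (induced_dco ?P) id"
    unfolding dco_mor_iff induced_dco_sel(1)
  proof (intro conjI ballI)
    fix \<alpha> assume \<alpha>: "\<alpha> \<in> pfuns D"
    \<comment> \<open>A one-element list [b] is coded by \<open>m (?x, b)\<close>, so \<alpha> is
      precomposed with \<open>q\<close> to act on codes before an element is chosen to represent
      it.\<close>
    obtain q where q: "q \<in> pfuns D" "\<And>b. b \<in> carrier D \<Longrightarrow> q (m (?x, b)) = Some b"
      using meet_proj[OF m] x by metis
    obtain \<gamma> where \<gamma>: "\<gamma> \<in> pfuns D" "\<And>x y z. q x = Some y \<Longrightarrow> \<alpha> y = Some z \<Longrightarrow> \<gamma> x = Some z"
      using pfuns_comp[OF D q(1) \<alpha>] by blast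
    obtain e where e: "e \<in> carrier D" "\<And>as. length as = Suc 0 \<Longrightarrow> set as \<subseteq> carrier D \<Longrightarrow>
        \<gamma> (foldl (curry m) ?x as) \<preceq> app_list ?P e as"
      using represent[OF \<gamma>(1), of 0] by blast
    have "(app ?P e |` carrier D) (id b) = Some (id y)" if y: "\<alpha> b = Some y" for b y
    proof -
      have b: "b \<in> carrier D" using pfuns_closed(1)[OF D \<alpha> y] .
      have "\<gamma> (m (?x, b)) = Some y" using \<gamma>(2)[OF q(2)[OF b] y] .
      with e(2)[of "[b]"] b show ?thesis by (simp add: app_list_def def_le_def)
    qed
    moreover have "app ?P e |` carrier D \<in> pfuns (induced_dco ?P)"
      unfolding induced_dco_sel(2) using e(1) by auto
    ultimately show "\<exists>\<beta>\<in>pfuns (induced_dco ?P). \<forall>b y. \<alpha> b = Some y \<longrightarrow> \<beta> (id b) = Some (id y)"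
      by blast
  qed simp
  moreover have "dco_mor (induced_dco ?P) D id"
    unfolding dco_mor_iff induced_dco_sel(1)
  proof (intro conjI ballI)
    fix \<phi> assume "\<phi> \<in> pfuns (induced_dco ?P)"
    then obtain a where a: "a \<in> carrier D" "\<phi> = app ?P a |` carrier D"
      unfolding induced_dco_sel(2) by auto
    \<comment> \<open>Application of a fixed a is b to \<open>ap (m (a, b))\<close>: pair the
      constant a with the identity, then apply \<open>ap\<close>. The constant function is where
      shallowness enters.\<close>
    obtain \<kappa> where \<kappa>: "\<kappa> \<in> pfuns D" "\<And>b. b \<in> carrier D \<Longrightarrow> \<kappa> b = Some a"
      using pfuns_const[OF D t S a(1)] by blast
    obtain \<iota> where \<iota>: "\<iota> \<in> pfuns D" "\<And>b. b \<in> carrier D \<Longrightarrow> \<iota> b = Some b"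
      using pfuns_id[OF D] by blast
    obtain \<pi> where \<pi>: "\<pi> \<in> pfuns D"
        "\<And>x y z. \<kappa> x = Some y \<Longrightarrow> \<iota> x = Some z \<Longrightarrow> \<pi> x = Some (m (y, z))"
      using pfuns_pair[OF D m \<kappa>(1) \<iota>(1)] by blast
    obtain \<gamma> where \<gamma>: "\<gamma> \<in> pfuns D" "\<And>x y z. \<pi> x = Some y \<Longrightarrow> ap y = Some z \<Longrightarrow> \<gamma> x = Some z"
      using pfuns_comp[OF D \<pi>(1) ap] by blast
    have "\<gamma> (id b) = Some (id y)" if "\<phi> b = Some y" for b y
    proof -
      have "b \<in> carrier D" "ap (m (a, b)) = Some y"
        using that unfolding a(2) by (auto simp: restrict_map_def split: if_splits)
      with \<gamma>(2) \<pi>(2) \<kappa>(2) \<iota>(2) show ?thesis by simp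
    qed
    with \<gamma>(1) show "\<exists>\<beta>\<in>pfuns D. \<forall>b y. \<phi> b = Some y \<longrightarrow> \<beta> (id b) = Some (id y)" by blast
  qed simp
  ultimately have "dco_isomorphic D (induced_dco ?P)"
    unfolding dco_isomorphic_def by (intro exI[of _ id]) simp
  with pca show ?thesis by blast
qed

text \<open>HOL cannot quantify over types inside a formula. The PCA that has to be constructed can
  be taken on the type of \<open>D\<close>, so the equivalence is stated there; the second conjunct
  extends the direction from PCAs to those on an arbitrary type.\<close>

theorem corollary2p15:
  fixes D :: "'a dco"
  assumes "is_dco D"
  shows "((\<exists>P :: 'a pas. is_pca P \<and> dco_isomorphic D (induced_dco P)) \<longleftrightarrow>
            cartesian D \<and> shallow D \<and> functionally_complete D)
       \<and> (\<forall>P :: 'b pas. is_pca P \<and> dco_isomorphic D (induced_dco P) \<longrightarrow>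
            cartesian D \<and> shallow D \<and> functionally_complete D)"
proof -
  have "\<exists>P :: 'a pas. is_pca P \<and> dco_isomorphic D (induced_dco P)"
    if "cartesian D \<and> shallow D \<and> functionally_complete D"
    using that pca_of_dco[OF assms] unfolding cartesian_def functionally_complete_def by blast
  moreover have "cartesian D \<and> shallow D \<and> functionally_complete D"
    if "is_pca P \<and> dco_isomorphic D (induced_dco P)" for P :: "'a pas"
    using that pca_iso_imp[OF assms] by blast
  moreover have "cartesian D \<and> shallow D \<and> functionally_complete D"
    if "is_pca P \<and> dco_isomorphic D (induced_dco P)" for P :: "'b pas"
    using that pca_iso_imp[OF assms] by blast
  ultimately show ?thesis by blast
qed

end
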